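(* Let $x,y$ be positive integers and let $A(r,s|x,y)$, for integers $r,s\ge 0$, be the Carlitz–Scoville generalised Eulerian numbers. Then for all integers $r,s\ge0$, $$A(r,s|x,y)=\frac{1}{(x+y-1)!}A_{(0^r,1^{y-1},r+s+1,1^{x-1},0^s)}(1).$$
   Context: The Carlitz–Scoville generalised Eulerian numbers $A(r,s|x,y)$ ($r,s\ge 0$ integers, $x,y$ positive integers) are determined by $A(0,0|x,y)=1$ and $A(r,s|x,y)=(s+x)A(r-1,s|x,y)+(r+y)A(r,s-1|x,y)$, with the convention that terms with a negative index are $0$. A configuration of size $n$ is a tuple $c=(c_1,\dots,c_n)$ of nonnegative integers with $\sum_i c_i=n$, viewed as $c_i$ balls at site $i\in\mathbb{Z}$. Here $0^k$ (resp. $1^k$) denotes $k$ zeros (resp. ones) and juxtaposition denotes concatenation; the configuration $(0^r,1^{y-1},r+s+1,1^{x-1},0^s)$ has size $r+s+x+y-1$. For real $q>0$, random dynamic: balls are dropped onto $\mathbb{Z}$ one at a time from their sites; a ball landing on an occupied site moves one site left with probability $q/(1+q)$ and right with probability $1/(1+q)$, repeating until it reaches an unoccupied site, where it settles; the law of the final occupied set does not depend on the dropping order. $\mathbb{P}_c(q)$ is the probability that the final occupied set is $[1;n]$. With $[i]=1+q+\dots+q^{i-1}$ and $[n]!=[1]\cdots[n]$, $A_c(q)=[n]!\,\mathbb{P}_c(q)$ is a polynomial in $q$, and $A_c(1)$ is its value at $q=1$. *)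

theory Defs
  imports "HOL-Probability.SPMF"
begin

text \<open>The recurrence with the terms of negative index already dropped.\<close>

fun carlitz_scoville :: "nat \<Rightarrow> nat \<Rightarrow> nat \<Rightarrow> nat \<Rightarrow> nat" where
  "carlitz_scoville 0 0 x y = 1"
| "carlitz_scoville (Suc r) 0 x y = (0 + x) * carlitz_scoville r 0 x y"
| "carlitz_scoville 0 (Suc s) x y = (0 + y) * carlitz_scoville 0 s x y"
| "carlitz_scoville (Suc r) (Suc s) x y =
     (Suc s + x) * carlitz_scoville r (Suc s) x y + (Suc r + y) * carlitz_scoville (Suc r) s x y"

text \<open>
  The random walk of one ball dropped at site \<open>i\<close> when the occupied set is \<open>S\<close>, returning the
  site where it settles. As the least fixed point, \<open>settle q S i\<close> gives to each site the
  probability that the walk stops there after finitely many steps; the remaining mass is the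
  probability that the walk never stops (which is zero when \<open>S\<close> is finite).
\<close>

partial_function (spmf) settle :: "real \<Rightarrow> int set \<Rightarrow> int \<Rightarrow> int spmf" where
  "settle q S i =
     (if i \<in> S
      then bind_spmf (spmf_of_pmf (bernoulli_pmf (q / (1 + q))))
             (\<lambda>left. settle q S (if left then i - 1 else i + 1))
      else return_spmf i)"

fun drop_balls :: "real \<Rightarrow> int list \<Rightarrow> int set \<Rightarrow> int set spmf" where
  "drop_balls q [] S = return_spmf S"
| "drop_balls q (i # is) S = bind_spmf (settle q S i) (\<lambda>j. drop_balls q is (insert j S))"

text \<open>
  A configuration \<open>(c\<^sub>1, \<dots>, c\<^sub>n)\<close> is a list; its 0-based entry \<open>c ! k\<close> counts the balls at site
  \<open>k + 1\<close>. The balls are listed from left to right; the order is irrelevant by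
  \<open>drop_balls_order\<close> below.
\<close>

definition is_configuration :: "nat \<Rightarrow> nat list \<Rightarrow> bool" where
  "is_configuration n c \<longleftrightarrow> length c = n \<and> sum_list c = n"

definition balls :: "nat list \<Rightarrow> int list" where
  "balls c = concat (map (\<lambda>k. replicate (c ! k) (int k + 1)) [0..<length c])"

definition prob_config :: "nat list \<Rightarrow> real \<Rightarrow> real" where
  "prob_config c q = spmf (drop_balls q (balls c) {}) {1..int (length c)}"

definition q_int :: "real \<Rightarrow> nat \<Rightarrow> real" where
  "q_int q i = (\<Sum>k<i. q ^ k)"

definition q_fact :: "real \<Rightarrow> nat \<Rightarrow> real" where
  "q_fact q n = (\<Prod>i=1..n. q_int q i)"

definition A_config :: "nat list \<Rightarrow> real \<Rightarrow> real" where
  "A_config c q = q_fact q (length c) * prob_config c q"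

definition cs_config :: "nat \<Rightarrow> nat \<Rightarrow> nat \<Rightarrow> nat \<Rightarrow> nat list" where
  "cs_config r s x y =
     replicate r 0 @ replicate (y - 1) 1 @ [r + s + 1] @ replicate (x - 1) 1 @ replicate s 0"

lemma is_configuration_cs_config:
  assumes "x > 0" "y > 0"
  shows "is_configuration (r + s + x + y - 1) (cs_config r s x y)"
  using assms by (cases x; cases y) (simp_all add: is_configuration_def cs_config_def sum_list_replicate)

lemma settle_notin: "i \<notin> S \<Longrightarrow> settle q S i = return_spmf i"
  by (subst settle.simps) simp

lemma settle_in:
  "i \<in> S \<Longrightarrow> settle q S i = bind_spmf (spmf_of_pmf (bernoulli_pmf (q / (1 + q))))
     (\<lambda>left. settle q S (if left then i - 1 else i + 1))"
  by (subst settle.simps) simp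

lemma settle_le:
  assumes eq: "\<And>S j. j \<in> S \<Longrightarrow> P S \<Longrightarrow> g S j = bind_spmf (spmf_of_pmf (bernoulli_pmf (q / (1 + q))))
     (\<lambda>left. g S (if left then j - 1 else j + 1))"
    and ret: "\<And>S j. j \<notin> S \<Longrightarrow> P S \<Longrightarrow> g S j = h j"
    and PS: "P S"
  shows "ord_spmf (=) (bind_spmf (settle q S j) h) (g S j)"
proof -
  have "\<forall>S j. P S \<longrightarrow> ord_spmf (=) (bind_spmf (settle q S j) h) (g S j)"
  proof (induction rule: settle.fixp_induct[where P="\<lambda>f. \<forall>S j. P S \<longrightarrow>
           ord_spmf (=) (bind_spmf (f q S j) h) (g S j)"])
    case 1 show ?case by simp
  next
    case 2 show ?case by simp
  next
    case (3 f)
    show ?case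
    proof (intro allI impI)
      fix S j assume P: "P S"
      show "ord_spmf (=) (bind_spmf (if j \<in> S
         then bind_spmf (spmf_of_pmf (bernoulli_pmf (q / (1 + q))))
             (\<lambda>left. f q S (if left then j - 1 else j + 1))
         else return_spmf j) h) (g S j)"
      proof (cases "j \<in> S")
        case True
        then show ?thesis using 3 P by (auto simp: eq simp del: bind_spmf_of_pmf intro!: bind_spmf_mono' ord_spmf_reflI)
      next
        case False
        then show ?thesis using P by (simp add: ret ord_spmf_reflI)
      qed
    qed
  qed
  then show ?thesis using PS by blast
qed

lemma set_settle: "j \<in> set_spmf (settle q S i) \<Longrightarrow> j \<notin> S"
proof -
  let ?h = "\<lambda>j. if j \<in> S then return_pmf None else return_spmf j"
  have "ord_spmf (=) (bind_spmf (settle q S i) return_spmf) (bind_spmf (settle q S i) ?h)"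
  proof (rule settle_le[where P="\<lambda>S'. S' = S" and g="\<lambda>S i. bind_spmf (settle q S i) ?h"])
    fix S' j assume *: "j \<in> S'" "S' = S"
    show "bind_spmf (settle q S' j) ?h = bind_spmf (spmf_of_pmf (bernoulli_pmf (q / (1 + q))))
     (\<lambda>left. bind_spmf (settle q S' (if left then j - 1 else j + 1)) ?h)"
      by (subst settle_in[OF *(1)]) (simp del: bind_spmf_of_pmf)
  qed (auto simp: settle_notin)
  then have "set_spmf (settle q S i) \<subseteq> set_spmf (bind_spmf (settle q S i) ?h)"
    by (simp add: ord_spmf_eqD_set_spmf)
  then show "j \<in> set_spmf (settle q S i) \<Longrightarrow> j \<notin> S"
    by (auto simp: set_bind_spmf split: if_splits)
qed

lemma settle_markov:
  assumes "S \<subseteq> T"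
  shows "bind_spmf (settle q S j) (settle q T) = settle q T j"
proof (rule spmf.leq_antisym)
  show "ord_spmf (=) (bind_spmf (settle q S j) (settle q T)) (settle q T j)"
    using assms
    by (intro settle_le[where P="\<lambda>S. S \<subseteq> T" and g="\<lambda>S. settle q T"]) (auto simp: settle_in subset_iff)
next
  have "\<forall>j. ord_spmf (=) (settle q T j) (settle q T j) \<and>
          ord_spmf (=) (settle q T j) (bind_spmf (settle q S j) (settle q T))"
  proof (induction rule: settle.fixp_induct[where P="\<lambda>f. \<forall>j. ord_spmf (=) (f q T j) (settle q T j) \<and>
          ord_spmf (=) (f q T j) (bind_spmf (settle q S j) (settle q T))"])
    case 1 show ?case by simp
  next
    case 2 show ?case by simp
  next
    case (3 f)
    let ?F = "\<lambda>j. if j \<in> T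
         then bind_spmf (spmf_of_pmf (bernoulli_pmf (q / (1 + q))))
             (\<lambda>left. f q T (if left then j - 1 else j + 1))
         else return_spmf j"
    have le: "ord_spmf (=) (?F j) (settle q T j)" for j
      using 3 by (auto simp: settle_in settle_notin simp del: bind_spmf_of_pmf intro!: bind_spmf_mono' ord_spmf_reflI)
    have "ord_spmf (=) (?F j) (bind_spmf (settle q S j) (settle q T))" for j
    proof (cases "j \<in> S")
      case True
      then show ?thesis
        using 3 assms by (auto simp: settle_in[OF True] simp del: bind_spmf_of_pmf intro!: bind_spmf_mono' ord_spmf_reflI)
    next
      case False
      then show ?thesis using le[of j] by (simp add: settle_notin)
    qed
    with le show ?case by blast
  qed
  then show "ord_spmf (=) (settle q T j) (bind_spmf (settle q S j) (settle q T))" by simp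
qed

lemma drop_balls_swap: "drop_balls q (i # j # is) S = drop_balls q (j # i # is) S"
proof -
  let ?D = "\<lambda>T. drop_balls q is T"
  let ?E = "\<lambda>j T. bind_spmf (settle q T j) (\<lambda>b. ?D (insert b T))"
  have outside: "?E j (insert a S) = bind_spmf (settle q S j) (\<lambda>b. ?E a (insert b S))"
    if "a \<notin> S" for a
  proof -
    have "?E a (insert b S) = bind_spmf (settle q (insert a S) b) (\<lambda>c. ?D (insert c (insert a S)))"
      if "b \<in> set_spmf (settle q S j)" for b
      using set_settle[OF that] \<open>a \<notin> S\<close>
      by (cases "a = b") (auto simp: settle_notin insert_commute)
    then have "bind_spmf (settle q S j) (\<lambda>b. ?E a (insert b S)) =
        bind_spmf (settle q S j)
          (\<lambda>b. bind_spmf (settle q (insert a S) b) (\<lambda>c. ?D (insert c (insert a S))))"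
      by (rule bind_spmf_cong[OF refl])
    also have "\<dots> = bind_spmf (bind_spmf (settle q S j) (settle q (insert a S)))
        (\<lambda>c. ?D (insert c (insert a S)))"
      by simp
    finally show ?thesis by (simp add: settle_markov[OF subset_insertI])
  qed
  have "drop_balls q (j # i # is) S = bind_spmf (settle q S j) (\<lambda>b. ?E i (insert b S))"
    by simp
  also have "\<dots> = bind_spmf (settle q S j)
      (\<lambda>b. bind_spmf (settle q S i) (\<lambda>a. ?E a (insert b S)))"
    by (subst settle_markov[OF subset_insertI, symmetric]) simp
  also have "\<dots> = bind_spmf (settle q S i)
      (\<lambda>a. bind_spmf (settle q S j) (\<lambda>b. ?E a (insert b S)))"
    by (rule bind_commute_spmf)
  also have "\<dots> = bind_spmf (settle q S i) (\<lambda>a. ?E j (insert a S))"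
    by (rule bind_spmf_cong[OF refl], rule outside[symmetric], rule set_settle)
  finally show ?thesis by simp
qed

lemma drop_balls_order:
  assumes "mset is = mset js"
  shows "drop_balls q is S = drop_balls q js S"
  using assms
proof (induction "length is" arbitrary: "is" js S rule: less_induct)
  case less
  show ?case
  proof (cases "is")
    case Nil
    then show ?thesis using less.prems by simp
  next
    case (Cons i xs)
    have move: "drop_balls q (us @ i # vs) S = drop_balls q (i # us @ vs) S" for us vs S
    proof (induction us arbitrary: S)
      case (Cons u us)
      then have "drop_balls q ((u # us) @ i # vs) S = drop_balls q (u # i # us @ vs) S"
        by (simp del: drop_balls.simps add: drop_balls.simps(2)[of q u])
      then show ?case by (simp only: drop_balls_swap append_Cons)
    qed simp
    have "i \<in> set js" using less.prems Cons mset_eq_setD by fastforce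
    then obtain us vs where js: "js = us @ i # vs" by (meson split_list)
    have "drop_balls q xs T = drop_balls q (us @ vs) T" for T
      using less.prems Cons js by (intro less.hyps) auto
    then show ?thesis by (simp only: Cons js move) simp
  qed
qed

end

theory Submission
  imports Defs
begin

text \<open>
  Drop one ball at each of the \<open>x + y - 1\<close> middle sites first, which fills an interval
  deterministically; the other \<open>r + s\<close> balls all start at one site \<open>p\<close> of it. For \<open>q = 1\<close> the
  walk is symmetric, so by gambler's ruin a ball extends the occupied interval \<open>[a; b]\<close> to the left
  with probability \<open>(b + 1 - p) / (b - a + 2)\<close> and to the right with probability
  \<open>(p - a + 1) / (b - a + 2)\<close>. After \<open>i\<close> extensions to the left and \<open>j\<close> to the right these are
  \<open>(x + j) / (x + y + i + j)\<close> and \<open>(y + i) / (x + y + i + j)\<close>, so conditioning on the last ball gives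
  the Carlitz--Scoville recurrence, up to the factor \<open>(x + y + i + j - 1)! / (x + y - 1)!\<close>.
\<close>

section \<open>Gambler's ruin for the symmetric walk on an interval\<close>

text \<open>The second differences of \<open>g\<close> vanish at the interior points 1, ..., N, so
  two consecutive values determine the next one.\<close>

lemma affine_if_midpoints:
  fixes g :: "nat \<Rightarrow> real"
  assumes "\<And>m. m < N \<Longrightarrow> 2 * g (Suc m) = g m + g (Suc (Suc m))" and "m \<le> Suc N"
  shows "g m = g 0 + real m * (g 1 - g 0)"
  using assms(2)
proof (induction m rule: less_induct)
  case (less m)
  consider "m = 0" | "m = 1" | k where "m = Suc (Suc k)"
    by (metis One_nat_def not0_implies_Suc)
  then show ?case
  proof cases
    case 3
    then show ?thesis
      using assms(1)[of k] less.IH[of k] less.IH[of "Suc k"] less.prems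
      by (simp add: algebra_simps)
  qed auto
qed

lemma spmf_settle_in:
  assumes "j \<in> S"
  shows "spmf (settle 1 S j) k = (spmf (settle 1 S (j - 1)) k + spmf (settle 1 S (j + 1)) k) / 2"
  by (subst settle_in[OF assms]) (simp add: pmf_bind)

text \<open>For each site \<open>k\<close>, the probability of settling at \<open>k\<close> is
  harmonic in the starting point, hence affine; its values at the two exits are known because a walk
  started there stops at once. The two interpolated masses add up to 1, so almost sure termination
  comes for free.\<close>

lemma settle_interval:
  fixes a b p :: int
  assumes "a \<le> p" "p \<le> b"
  shows "settle 1 {a..b} p =
    map_spmf (\<lambda>left. if left then a - 1 else b + 1)
      (spmf_of_pmf (bernoulli_pmf (real_of_int (b + 1 - p) / real_of_int (b - a + 2))))"
    (is "_ = ?R")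
proof (rule spmf_eqI)
  fix k
  define N where "N = nat (b - a + 1)"
  have N: "int N = b - a + 1" using assms by (simp add: N_def)
  \<comment> \<open>Index 0 is the left exit \<open>a - 1\<close>, the indices 1, ...,
    \<open>N\<close> are the occupied sites, and \<open>Suc N\<close> is the right exit
    \<open>b + 1\<close>.\<close>
  define g where "g m = spmf (settle 1 {a..b} (a - 1 + int m)) k" for m
  have mid: "2 * g (Suc m) = g m + g (Suc (Suc m))" if "m < N" for m
    using that N unfolding g_def
    by (subst spmf_settle_in) (auto simp: algebra_simps)
  define t where "t = nat (p - a + 1)"
  have t: "int t = p - a + 1" using assms by (simp add: t_def)
  have "g 0 = indicator {a - 1} k"
    by (auto simp: g_def settle_notin indicator_def)
  moreover have "g (Suc N) = indicator {b + 1} k"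
    by (auto simp: g_def settle_notin indicator_def N)
  moreover have "g (Suc N) = g 0 + real (Suc N) * (g 1 - g 0)"
    by (rule affine_if_midpoints[where N=N]) (use mid in auto)
  moreover have "g t = g 0 + real t * (g 1 - g 0)"
    by (rule affine_if_midpoints[where N=N]) (use mid t N assms in auto)
  \<comment> \<open>This eliminates the unknown slope \<open>g 1 - g 0\<close>: the value at
    \<open>t\<close> becomes a weighted mean of the two exit values.\<close>
  moreover have "real (Suc N) * (g 0 + real t * (g 1 - g 0)) =
      (real (Suc N) - real t) * g 0 + real t * (g 0 + real (Suc N) * (g 1 - g 0))"
    by (simp only: algebra_simps)
  ultimately have "real (Suc N) * g t =
      (real (Suc N) - real t) * indicator {a - 1} k + real t * indicator {b + 1} k"
    by simp
  moreover have "real (Suc N) = real_of_int (b - a + 2)" "real t = real_of_int (p - a + 1)"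
    "real (Suc N) - real t = real_of_int (b + 1 - p)"
    using N t by linarith+
  ultimately have "real_of_int (b - a + 2) * g t = real_of_int (b + 1 - p) * indicator {a - 1} k
      + real_of_int (p - a + 1) * indicator {b + 1} k"
    by (simp only:)
  moreover have ne: "real_of_int (b - a + 2) \<noteq> 0" using assms by linarith
  ultimately have g: "g t = (real_of_int (b + 1 - p) * indicator {a - 1} k
      + real_of_int (p - a + 1) * indicator {b + 1} k) / real_of_int (b - a + 2)"
    by (metis nonzero_mult_div_cancel_left)
  \<comment> \<open>With the parameter in [0, 1], the Bernoulli masses are the parameter and its
    complement.\<close>
  have "0 \<le> real_of_int (b + 1 - p) / real_of_int (b - a + 2)"
    "real_of_int (b + 1 - p) / real_of_int (b - a + 2) \<le> 1"
    using assms by simp_all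
  then have "spmf ?R k = real_of_int (b + 1 - p) / real_of_int (b - a + 2) * indicator {a - 1} k
      + (1 - real_of_int (b + 1 - p) / real_of_int (b - a + 2)) * indicator {b + 1} k"
    by (simp add: map_spmf_conv_bind_spmf pmf_bind indicator_def del: map_spmf_of_pmf)
  also have "1 - real_of_int (b + 1 - p) / real_of_int (b - a + 2) =
      real_of_int (p - a + 1) / real_of_int (b - a + 2)"
    using ne by (simp add: diff_divide_eq_iff)
  also have "real_of_int (b + 1 - p) / real_of_int (b - a + 2) * indicator {a - 1} k
      + real_of_int (p - a + 1) / real_of_int (b - a + 2) * indicator {b + 1} k = g t"
    by (simp only: g add_divide_distrib times_divide_eq_left)
  finally show "spmf (settle 1 {a..b} p) k = spmf ?R k"
    by (simp add: g_def t)
qed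

section \<open>Law of the occupied interval\<close>

lemma drop_balls_append:
  "drop_balls q (is @ js) S = bind_spmf (drop_balls q is S) (drop_balls q js)"
  by (induction "is" arbitrary: S) simp_all

lemma drop_balls_distinct:
  assumes "distinct is" "set is \<inter> S = {}"
  shows "drop_balls q is S = return_spmf (set is \<union> S)"
  using assms by (induction "is" arbitrary: S) (auto simp: settle_notin)

text \<open>The law of the number of extensions to the left after \<open>n\<close> of the balls starting at \<open>p\<close>.\<close>

primrec left_count :: "nat \<Rightarrow> nat \<Rightarrow> nat \<Rightarrow> nat pmf" where
  "left_count x y 0 = return_pmf 0"
| "left_count x y (Suc n) = bind_pmf (left_count x y n) (\<lambda>i.
     map_pmf (\<lambda>left. if left then Suc i else i)
       (bernoulli_pmf (real (x + n - i) / real (x + y + n))))"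

lemma set_pmf_left_count: "i \<in> set_pmf (left_count x y n) \<Longrightarrow> i \<le> n"
  by (induction n arbitrary: i) (fastforce split: if_splits)+

text \<open>The occupied set stays an interval containing \<open>p\<close>, so after
  \<open>n\<close> balls the number \<open>i\<close> of left extensions determines it: the other
  \<open>n - i\<close> balls extended it to the right.\<close>

lemma drop_balls_replicate:
  fixes p :: int
  assumes "x > 0" "y > 0"
  shows "drop_balls 1 (replicate n p) {p - int y + 1..p + int x - 1} =
    map_spmf (\<lambda>i. {p - int y + 1 - int i..p + int x - 1 + int (n - i)})
      (spmf_of_pmf (left_count x y n))"
proof (induction n)
  case (Suc n)
  let ?I = "\<lambda>n i. {p - int y + 1 - int i..p + int x - 1 + int (n - i)}"
  have step: "bind_spmf (settle 1 (?I n i) p) (\<lambda>j. return_spmf (insert j (?I n i))) =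
      map_spmf (?I (Suc n)) (spmf_of_pmf (map_pmf (\<lambda>left. if left then Suc i else i)
       (bernoulli_pmf (real (x + n - i) / real (x + y + n)))))"
    if "i \<in> set_pmf (left_count x y n)" for i
  proof -
    have i: "i \<le> n" using set_pmf_left_count that .
    \<comment> \<open>Distance from \<open>p\<close> to the right exit, and distance between the two
      exits.\<close>
    have prob: "real_of_int (p + int x - 1 + int (n - i) + 1 - p) = real (x + n - i)"
      "real_of_int (p + int x - 1 + int (n - i) - (p - int y + 1 - int i) + 2) = real (x + y + n)"
      using i by (simp_all add: of_nat_diff)
    have ins: "insert (if left then p - int y + 1 - int i - 1 else p + int x - 1 + int (n - i) + 1) (?I n i)
        = ?I (Suc n) (if left then Suc i else i)" for left
      using i assms by (auto simp: of_nat_diff)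
    have "settle 1 (?I n i) p =
      map_spmf (\<lambda>left. if left then p - int y + 1 - int i - 1 else p + int x - 1 + int (n - i) + 1)
        (spmf_of_pmf (bernoulli_pmf (real (x + n - i) / real (x + y + n))))"
      using assms by (subst settle_interval) (auto simp only: prob)
    then show ?thesis
      by (simp add: map_spmf_conv_bind_spmf[symmetric] spmf.map_comp o_def ins
            spmf_of_pmf_def pmf.map_comp)
  qed
  \<comment> \<open>\<open>drop_balls\<close> peels off the first ball but \<open>left_count\<close>
    conditions on the last, so the new ball is put at the end.\<close>
  have "replicate (Suc n) p = replicate n p @ [p]"
    by (simp add: replicate_append_same)
  then have "drop_balls 1 (replicate (Suc n) p) {p - int y + 1..p + int x - 1} =
      bind_pmf (left_count x y n)
        (\<lambda>i. bind_spmf (settle 1 (?I n i) p) (\<lambda>j. return_spmf (insert j (?I n i))))"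
    by (simp only: drop_balls_append Suc.IH) (simp add: bind_map_pmf)
  also have "\<dots> = bind_pmf (left_count x y n)
      (\<lambda>i. map_spmf (?I (Suc n)) (spmf_of_pmf (map_pmf (\<lambda>left. if left then Suc i else i)
       (bernoulli_pmf (real (x + n - i) / real (x + y + n))))))"
    by (rule bind_pmf_cong[OF refl step])
  also have "\<dots> = map_spmf (?I (Suc n)) (spmf_of_pmf (left_count x y (Suc n)))"
    by (simp add: spmf_of_pmf_def pmf.map_comp o_def map_bind_pmf)
  finally show ?case .
qed (simp add: spmf_of_pmf_def)

section \<open>Point probabilities and the Carlitz--Scoville recurrence\<close>

lemma pmf_left_step:
  assumes "i \<le> n" "y > 0"
  shows "pmf (map_pmf (\<lambda>left. if left then Suc i else i)
       (bernoulli_pmf (real (x + n - i) / real (x + y + n)))) k =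
    (if k = Suc i then real (x + n - i) / real (x + y + n)
     else if k = i then real (y + i) / real (x + y + n) else 0)"
proof -
  have "0 \<le> real (x + n - i) / real (x + y + n)" "real (x + n - i) / real (x + y + n) \<le> 1"
    using assms by simp_all
  moreover have "1 - real (x + n - i) / real (x + y + n) = real (y + i) / real (x + y + n)"
    using assms by (simp add: field_simps of_nat_diff)
  ultimately show ?thesis
    by (auto simp: map_pmf_def pmf_bind indicator_def)
qed

lemma pmf_left_count_0:
  assumes "y > 0"
  shows "pmf (left_count x y (Suc n)) 0 = pmf (left_count x y n) 0 * real y / real (x + y + n)"
proof -
  have "pmf (left_count x y (Suc n)) 0 = (\<Sum>i\<in>{0}. pmf (map_pmf (\<lambda>left. if left then Suc i else i)
       (bernoulli_pmf (real (x + n - i) / real (x + y + n)))) 0 * pmf (left_count x y n) i)"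
    unfolding left_count.simps pmf_bind
  proof (rule integral_measure_pmf_real)
    fix i assume "i \<in> set_pmf (left_count x y n)"
    then show "pmf (map_pmf (\<lambda>left. if left then Suc i else i)
       (bernoulli_pmf (real (x + n - i) / real (x + y + n)))) 0 \<noteq> 0 \<Longrightarrow> i \<in> {0}"
      using assms by (subst (asm) pmf_left_step) (auto dest: set_pmf_left_count split: if_splits)
  qed simp
  then show ?thesis using pmf_left_step[of 0 n y x 0] assms by simp
qed

text \<open>Conditioning on the last ball: the count \<open>Suc i\<close> arises from
  \<open>i\<close> by a left extension or from \<open>Suc i\<close> by a right one.\<close>

lemma pmf_left_count_Suc:
  assumes "y > 0" "i \<le> n"
  shows "pmf (left_count x y (Suc n)) (Suc i) =
    (real (x + n - i) * pmf (left_count x y n) i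
      + real (y + Suc i) * pmf (left_count x y n) (Suc i)) / real (x + y + n)"
proof -
  let ?B = "\<lambda>i. map_pmf (\<lambda>left. if left then Suc i else i)
       (bernoulli_pmf (real (x + n - i) / real (x + y + n)))"
  have "pmf (left_count x y (Suc n)) (Suc i) =
      (\<Sum>j\<in>{i, Suc i}. pmf (?B j) (Suc i) * pmf (left_count x y n) j)"
    unfolding left_count.simps pmf_bind
  proof (rule integral_measure_pmf_real)
    fix j assume "j \<in> set_pmf (left_count x y n)"
    then show "pmf (?B j) (Suc i) \<noteq> 0 \<Longrightarrow> j \<in> {i, Suc i}"
      using assms by (subst (asm) pmf_left_step) (auto dest: set_pmf_left_count split: if_splits)
  qed simp
  moreover have "pmf (?B i) (Suc i) = real (x + n - i) / real (x + y + n)"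
    using assms by (subst pmf_left_step) auto
  moreover have "pmf (?B (Suc i)) (Suc i) * pmf (left_count x y n) (Suc i) =
      real (y + Suc i) / real (x + y + n) * pmf (left_count x y n) (Suc i)"
  proof (cases "Suc i \<le> n")
    case True
    then show ?thesis using assms by (subst pmf_left_step) auto
  next
    case False
    then have "pmf (left_count x y n) (Suc i) = 0"
      using set_pmf_left_count by (metis pmf_eq_0_set_pmf)
    then show ?thesis by simp
  qed
  ultimately show ?thesis
    by (simp add: add_divide_distrib del: of_nat_add of_nat_Suc left_count.simps)
qed

text \<open>The drop after \<open>n\<close> earlier ones contributes the denominator
  \<open>x + y + n\<close>, and the factorials absorb the product of these. What remains are the
  numerators \<open>x + s\<close> (last extension to the left) and \<open>y + r\<close> (to the
  right), the coefficients of the recurrence.\<close>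

lemma fact_pmf_left_count:
  assumes "x > 0" "y > 0"
  shows "fact (x + y + r + s - 1) * pmf (left_count x y (r + s)) r =
    fact (x + y - 1) * real (carlitz_scoville r s x y)"
  using assms
proof (induction r s x y rule: carlitz_scoville.induct)
  case (1 x y)
  then show ?case by simp
next
  case (2 r x y)
  \<comment> \<open>With no right extensions the second term drops out: \<open>r\<close> balls
    cannot make \<open>Suc r\<close> left extensions.\<close>
  have "pmf (left_count x y r) (Suc r) = 0"
    using set_pmf_left_count[of "Suc r" x y r] by (auto simp: pmf_eq_0_set_pmf)
  then have "pmf (left_count x y (Suc r)) (Suc r) = real x * pmf (left_count x y r) r / real (x + y + r)"
    using 2 by (subst pmf_left_count_Suc) auto
  moreover have "fact (x + y + Suc r + 0 - 1) = real (x + y + r) * fact (x + y + r + 0 - 1)"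
    using 2 by (simp add: fact_reduce)
  ultimately have "fact (x + y + Suc r + 0 - 1) * pmf (left_count x y (Suc r + 0)) (Suc r) =
      real x * (fact (x + y + r + 0 - 1) * pmf (left_count x y (r + 0)) r)"
    using 2 by (simp del: of_nat_add left_count.simps)
  also have "\<dots> = real x * (fact (x + y - 1) * real (carlitz_scoville r 0 x y))"
    by (simp only: 2)
  finally show ?case by (simp del: left_count.simps)
next
  case (3 s x y)
  have "fact (x + y + 0 + Suc s - 1) = real (x + y + s) * fact (x + y + 0 + s - 1)"
    using 3 by (simp add: fact_reduce)
  then have "fact (x + y + 0 + Suc s - 1) * pmf (left_count x y (0 + Suc s)) 0 =
      real y * (fact (x + y + 0 + s - 1) * pmf (left_count x y (0 + s)) 0)"
    using 3 by (simp add: pmf_left_count_0 del: of_nat_add left_count.simps)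
  also have "\<dots> = real y * (fact (x + y - 1) * real (carlitz_scoville 0 s x y))"
    by (simp only: 3)
  finally show ?case by (simp del: left_count.simps)
next
  case (4 r s x y)
  let ?P = "\<lambda>i. pmf (left_count x y (Suc (r + s))) i"
  let ?M = "real (x + y + Suc (r + s))"
  let ?F = "fact (x + y + (r + s)) :: real"
  have IH: "?F * ?P r = fact (x + y - 1) * real (carlitz_scoville r (Suc s) x y)"
    "?F * ?P (Suc r) = fact (x + y - 1) * real (carlitz_scoville (Suc r) s x y)"
    using 4 by (simp_all del: left_count.simps add: add_ac)
  have "pmf (left_count x y (Suc (Suc (r + s)))) (Suc r) =
      (real (x + Suc s) * ?P r + real (y + Suc r) * ?P (Suc r)) / ?M"
    using 4 by (subst pmf_left_count_Suc) auto
  moreover have "fact (x + y + Suc r + Suc s - 1) = ?M * ?F"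
    by (simp add: algebra_simps)
  ultimately have "fact (x + y + Suc r + Suc s - 1) * pmf (left_count x y (Suc r + Suc s)) (Suc r) =
      ?F * (real (x + Suc s) * ?P r + real (y + Suc r) * ?P (Suc r))"
    by (simp del: of_nat_add of_nat_Suc left_count.simps)
  also have "\<dots> = real (x + Suc s) * (?F * ?P r) + real (y + Suc r) * (?F * ?P (Suc r))"
    by (simp only: algebra_simps)
  finally show ?case
    unfolding IH by (simp add: algebra_simps)
qed

section \<open>Reducing the configuration to balls dropped at one site\<close>

lemma balls_append: "balls (c @ d) = balls c @ map (\<lambda>i. i + int (length c)) (balls d)"
proof -
  have upt: "[0..<length (c @ d)] = [0..<length c] @ map (\<lambda>k. k + length c) [0..<length d]"
    by (simp add: map_add_upt upt_add_eq_append[of 0 "length c" "length d", simplified] add.commute)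
  have left: "map (\<lambda>k. replicate ((c @ d) ! k) (int k + 1)) [0..<length c] =
      map (\<lambda>k. replicate (c ! k) (int k + 1)) [0..<length c]"
    by (simp add: nth_append)
  have right: "map (\<lambda>k. replicate ((c @ d) ! k) (int k + 1)) (map (\<lambda>k. k + length c) [0..<length d]) =
      map (map (\<lambda>i. i + int (length c))) (map (\<lambda>k. replicate (d ! k) (int k + 1)) [0..<length d])"
    by (simp add: nth_append)
  show ?thesis
    by (simp only: balls_def upt map_append left right concat_append map_concat)
qed

lemma balls_replicate_0: "balls (replicate n 0) = []"
  by (simp add: balls_def)

lemma balls_replicate_1: "balls (replicate n 1) = map (\<lambda>k. int k + 1) [0..<n]"
proof -
  have "map (\<lambda>k. replicate (replicate n 1 ! k) (int k + 1)) [0..<n] = map (\<lambda>k. [int k + 1]) [0..<n]"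
    by (rule map_cong) auto
  then show ?thesis
    by (simp only: balls_def length_replicate concat_map_singleton)
qed

lemma balls_singleton: "balls [m] = replicate m 1"
  by (simp add: balls_def)

text \<open>Since the order is irrelevant, one ball from each nonempty site goes first. These balls
  settle where they start, leaving \<open>r + s\<close> balls at the heavy site
  \<open>r + y\<close>.\<close>

lemma drop_balls_cs_config:
  assumes "x > 0" "y > 0"
  shows "drop_balls q (balls (cs_config r s x y)) {} =
    drop_balls q (replicate (r + s) (int r + int y)) {int r + 1..int r + int x + int y - 1}"
proof -
  \<comment> \<open>\<open>L\<close> and \<open>R\<close> list the single-ball sites to the left and
    right of \<open>r + y\<close>.\<close>
  define L where "L = map (\<lambda>k. int k + 1 + int r) [0..<y - 1]"
  define R where "R = map (\<lambda>k. int k + 1 + int r + int y) [0..<x - 1]"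
  have "balls (cs_config r s x y) = L @ replicate (r + s + 1) (int r + int y) @ R"
    using assms
    by (simp only: cs_config_def balls_append balls_replicate_0 balls_replicate_1 balls_singleton)
      (simp add: L_def R_def o_def of_nat_diff add_ac)
  then have "drop_balls q (balls (cs_config r s x y)) {} =
      drop_balls q ((L @ [int r + int y] @ R) @ replicate (r + s) (int r + int y)) {}"
    by (intro drop_balls_order) simp
  also have "drop_balls q (L @ [int r + int y] @ R) {} = return_spmf (set (L @ [int r + int y] @ R))"
    by (subst drop_balls_distinct) (auto simp: L_def R_def distinct_map inj_on_def)
  then have "drop_balls q ((L @ [int r + int y] @ R) @ replicate (r + s) (int r + int y)) {} =
      drop_balls q (replicate (r + s) (int r + int y)) (set (L @ [int r + int y] @ R))"
    by (simp only: drop_balls_append return_bind_spmf)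
  also have "set (L @ [int r + int y] @ R) = {int r + 1..int r + int x + int y - 1}"
  proof (rule set_eqI)
    fix z
    have "z \<in> set L \<longleftrightarrow> int r + 1 \<le> z \<and> z < int r + int y"
      using assms by (auto simp: L_def image_iff intro!: bexI[of _ "nat (z - int r - 1)"])
    moreover have "z \<in> set R \<longleftrightarrow> int r + int y < z \<and> z < int r + int x + int y"
      using assms by (auto simp: R_def image_iff intro!: bexI[of _ "nat (z - int r - int y - 1)"])
    ultimately show "z \<in> set (L @ [int r + int y] @ R) \<longleftrightarrow> z \<in> {int r + 1..int r + int x + int y - 1}"
      using assms by auto
  qed
  finally show ?thesis .
qed

text \<open>The initial interval starts at \<open>r + 1\<close>, so the final one starts at 1
  exactly when \<open>r\<close> extensions went to the left.\<close>

lemma prob_config_cs_config: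
  assumes "x > 0" "y > 0"
  shows "prob_config (cs_config r s x y) 1 = pmf (left_count x y (r + s)) r"
proof -
  define p where "p = int r + int y"
  define I where "I i = {p - int y + 1 - int i..p + int x - 1 + int (r + s - i)}" for i
  have len: "length (cs_config r s x y) = r + s + x + y - 1"
    using is_configuration_cs_config[OF assms] by (simp add: is_configuration_def)
  have "{int r + 1..int r + int x + int y - 1} = {p - int y + 1..p + int x - 1}"
    by (auto simp: p_def)
  then have "drop_balls 1 (balls (cs_config r s x y)) {} =
      map_spmf I (spmf_of_pmf (left_count x y (r + s)))"
    unfolding drop_balls_cs_config[OF assms] I_def p_def[symmetric]
    using drop_balls_replicate[OF assms] by metis
  also have "\<dots> = spmf_of_pmf (map_pmf I (left_count x y (r + s)))"
    by (simp add: spmf_of_pmf_def pmf.map_comp o_def)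
  finally have D: "drop_balls 1 (balls (cs_config r s x y)) {} = \<dots>" .
  \<comment> \<open>The left endpoint recovers \<open>i\<close>, so the mass of the interval
    \<open>I r\<close> is the mass of the count \<open>r\<close> alone.\<close>
  have "inj I"
    using assms by (intro injI) (auto simp: I_def Icc_eq_Icc)
  moreover have "{1..int (length (cs_config r s x y))} = I r"
    using assms by (auto simp: len I_def p_def of_nat_diff)
  ultimately show ?thesis
    by (simp add: prob_config_def D pmf_map_inj')
qed

lemma q_fact_1: "q_fact 1 n = fact n"
  by (simp add: q_fact_def q_int_def fact_prod)

theorem theorem4p2:
  fixes x y r s :: nat
  assumes "x > 0" and "y > 0"
  shows "real (carlitz_scoville r s x y)
           = 1 / fact (x + y - 1) * A_config (cs_config r s x y) 1"
proof -
  have "length (cs_config r s x y) = x + y + r + s - 1"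
    using is_configuration_cs_config[OF assms] by (simp add: is_configuration_def)
  then have "A_config (cs_config r s x y) 1 =
      fact (x + y + r + s - 1) * pmf (left_count x y (r + s)) r"
    by (simp only: A_config_def q_fact_1 prob_config_cs_config[OF assms])
  then show ?thesis
    by (simp only: fact_pmf_left_count[OF assms]) simp
qed

end
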